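(* Let $\epsilon>0$, $\kappa>0$, and let $(\hat{x}_i,\hat{y}_i)\in\mathbb{R}^n\times\{-1,+1\}$, $i=1,\dots,N$, be given. Consider the convex program in the variables $\beta\in\mathbb{R}^n$, $s\in\mathbb{R}^N$, $\lambda\in\mathbb{R}$: $$\begin{aligned}\min_{\beta,\,s,\,\lambda}\quad & \lambda\epsilon+\frac1N\sum_{i=1}^N s_i\\ \text{s.t.}\quad & \ell_\beta(\hat{x}_i,\hat{y}_i)\le s_i,\quad i=1,\dots,N,\\ & \ell_\beta(\hat{x}_i,-\hat{y}_i)-\lambda\kappa\le s_i,\quad i=1,\dots,N,\\ & \|\beta\|_\infty\le\lambda,\end{aligned}$$ where $\ell_\beta(x,y)=\log(1+\exp(-y\beta^Tx))$. If $(\beta^*,\lambda^*,s^* )$ is an optimal solution of this program, then $$\lambda^*\le\lambda^U=\frac{0.2785}{\epsilon}.$$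
   Context: This program is the convex reformulation of the Wasserstein distributionally robust logistic regression problem with Wasserstein radius $\epsilon$, label-reliability parameter $\kappa$, and transport cost induced by the $\ell_1$-norm (whose dual norm is $\|\cdot\|_\infty$). *)

theory Defs
  imports "HOL-Analysis.Analysis"
begin

definition logloss :: "real ^ 'n \<Rightarrow> real ^ 'n \<Rightarrow> real \<Rightarrow> real" where
  "logloss \<beta> x y = ln (1 + exp (- y * (\<beta> \<bullet> x)))"

text \<open>The sample size is \<open>N = CARD('m)\<close>; \<open>xh\<close> and \<open>yh\<close> are the sample points and labels.
  The library's \<open>infnorm\<close> on \<open>real ^ 'n\<close> is the maximum of the absolute values of the
  coordinates (lemma \<open>infnorm_cart\<close>).\<close>

definition drlr_objective :: "real \<Rightarrow> (real ^ 'n) \<times> (real ^ 'm) \<times> real \<Rightarrow> real" where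
  "drlr_objective \<epsilon> = (\<lambda>(\<beta>, s, l). l * \<epsilon> + 1 / real CARD('m) * (\<Sum>i\<in>UNIV. s $ i))"

definition drlr_feasible ::
  "real \<Rightarrow> ('m \<Rightarrow> real ^ 'n) \<Rightarrow> ('m \<Rightarrow> real) \<Rightarrow> (real ^ 'n) \<times> (real ^ 'm) \<times> real \<Rightarrow> bool" where
  "drlr_feasible \<kappa> xh yh = (\<lambda>(\<beta>, s, l).
     (\<forall>i. logloss \<beta> (xh i) (yh i) \<le> s $ i) \<and>
     (\<forall>i. logloss \<beta> (xh i) (- yh i) - l * \<kappa> \<le> s $ i) \<and>
     infnorm \<beta> \<le> l)"

definition drlr_optimal ::
  "real \<Rightarrow> real \<Rightarrow> ('m \<Rightarrow> real ^ 'n) \<Rightarrow> ('m \<Rightarrow> real) \<Rightarrow> (real ^ 'n) \<times> (real ^ 'm) \<times> real \<Rightarrow> bool" where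
  "drlr_optimal \<epsilon> \<kappa> xh yh = is_arg_min (drlr_objective \<epsilon>) (drlr_feasible \<kappa> xh yh)"

end

theory Submission
  imports Defs
begin

text \<open>Shrink an optimal solution towards the origin: for \<open>0 < t < 1\<close> replace
  \<open>(\<beta>, \<lambda>)\<close> by \<open>(t \<beta>, t \<lambda>)\<close> and shift each \<open>s\<^sub>i\<close> by
  \<open>L (t z\<^sub>i) - L z\<^sub>i\<close>, where \<open>L z = ln (1 + exp (- z))\<close> and
  \<open>z\<^sub>i\<close> is the margin of the \<open>i\<close>-th sample. As \<open>L (- z) = L z + z\<close>, the second
  constraint says that \<open>s\<^sub>i - L z\<^sub>i\<close>, which is nonnegative by the first constraint, is at least
  \<open>z\<^sub>i - \<lambda> \<kappa>\<close>, and so also at least \<open>t (z\<^sub>i - \<lambda> \<kappa>)\<close>: the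
  shifted point is feasible. By convexity of \<open>L\<close> its objective exceeds the old one by at most
  \<open>(1 - t) (c / t - \<lambda> \<epsilon>)\<close>, where \<open>c\<close> bounds \<open>u / (1 + exp u)\<close>.
  Optimality gives \<open>t \<lambda> \<epsilon> \<le> c\<close>, and it remains to let \<open>t\<close> tend to 1.
  The optimal \<open>c\<close> is the Lambert value \<open>W (1 / e) = 0.27846\<dots>\<close>.\<close>

text \<open>Tangent inequality at \<open>u\<close> for the convex \<open>ln (1 + exp (- z))\<close>,
  of slope \<open>- p\<close>; Jensen for \<open>exp\<close> with weight \<open>p\<close> replaces
  derivatives.\<close>

lemma ln_add_exp_uminus_diff_le:
  fixes u v :: real
  shows "ln (1 + exp (- u)) - ln (1 + exp (- v)) \<le> (v - u) / (1 + exp u)"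
proof -
  define p where "p = 1 / (1 + exp u)"
  have pos: "0 < 1 + exp u" "0 < 1 + exp (- u)" "0 < 1 + exp (- v)"
    by (simp_all add: add_pos_pos)
  have p: "0 \<le> p" "p \<le> 1"
    using pos by (simp_all add: p_def)
  have "1 - p = 1 / (1 + exp (- u))" "p * exp (u - v) = exp (- v) / (1 + exp (- u))"
    using pos by (simp_all add: p_def exp_diff exp_minus divide_simps)
  then have "(1 - p) * exp 0 + p * exp (u - v) = (1 + exp (- v)) / (1 + exp (- u))"
    by (simp add: add_divide_distrib)
  moreover have "exp (p * (u - v)) \<le> (1 - p) * exp 0 + p * exp (u - v)"
    using convex_onD[OF exp_convex p, of 0 "u - v"] by simp
  ultimately have "exp (p * (u - v)) \<le> (1 + exp (- v)) / (1 + exp (- u))"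
    by simp
  then have "p * (u - v) \<le> ln ((1 + exp (- v)) / (1 + exp (- u)))"
    using pos by (subst ln_ge_iff) simp_all
  also have "\<dots> = ln (1 + exp (- v)) - ln (1 + exp (- u))"
    using pos by (simp add: ln_div)
  finally show ?thesis
    by (simp add: p_def algebra_simps diff_divide_distrib)
qed

lemma ln_add_exp_eq: "ln (1 + exp z) = ln (1 + exp (- z)) + z" for z :: real
proof -
  have "1 + exp z = (1 + exp (- z)) * exp z"
    by (simp add: algebra_simps flip: exp_add)
  moreover have "0 < 1 + exp (- z)"
    by (simp add: add_pos_pos)
  ultimately show ?thesis
    by (simp add: ln_mult)
qed

text \<open>The tangent to \<open>exp\<close> at \<open>1 + c\<close> gives the bound by \<open>c\<close>
  as soon as \<open>c * exp (1 + c) \<ge> 1\<close>.\<close>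
lemma divide_add_exp_le: "u / (1 + exp u) \<le> 0.2785" for u :: real
proof -
  \<comment> \<open>Seven terms fall short of \<open>1 / 0.2785\<close>; eight suffice, and the even
    order makes the remainder nonnegative.\<close>
  have "1 / 0.2785 \<le> (\<Sum>k<8. (1.2785::real) ^ k / fact k)"
    by (simp add: lessThan_nat_numeral fact_numeral power_divide)
  also have "\<dots> \<le> exp 1.2785"
    using Maclaurin_exp_le[of "1.2785" 8] by (auto simp: zero_le_even_power)
  finally have "1 / 0.2785 \<le> exp (1.2785::real)" .
  then have "1 * exp (u - 1.2785) \<le> (0.2785 * exp 1.2785) * exp (u - 1.2785)"
    by (intro mult_right_mono) simp_all
  also have "\<dots> = 0.2785 * exp u"
    by (simp add: mult.assoc flip: exp_add)
  finally have "u - 0.2785 \<le> 0.2785 * exp u"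
    using exp_ge_add_one_self[of "u - 1.2785"] by simp
  then show ?thesis
    by (simp add: divide_le_eq add_pos_pos algebra_simps)
qed

lemma drlr_feasible_shrink:
  fixes \<beta> :: "real ^ 'n" and s :: "real ^ 'm::finite"
  assumes "drlr_feasible \<kappa> xh yh (\<beta>, s, l)" and "0 \<le> t" "t \<le> 1"
  shows "drlr_feasible \<kappa> xh yh
    (t *\<^sub>R \<beta>,
     \<chi> i. s $ i + (logloss (t *\<^sub>R \<beta>) (xh i) (yh i) - logloss \<beta> (xh i) (yh i)),
     t * l)"
proof -
  have swap: "logloss b x (- y) = logloss b x y + y * (b \<bullet> x)"
    for b x :: "real ^ 'n" and y
    using ln_add_exp_eq[of "y * (b \<bullet> x)"] by (simp add: logloss_def)
  have "t * (yh i * (\<beta> \<bullet> xh i) - l * \<kappa>) \<le> s $ i - logloss \<beta> (xh i) (yh i)" for i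
  proof -
    let ?d = "yh i * (\<beta> \<bullet> xh i) - l * \<kappa>"
    have "t * ?d \<le> t * (s $ i - logloss \<beta> (xh i) (yh i))"
      using assms(1) \<open>0 \<le> t\<close>
      by (intro mult_left_mono) (auto simp: drlr_feasible_def swap algebra_simps)
    also have "\<dots> \<le> s $ i - logloss \<beta> (xh i) (yh i)"
      using assms by (intro mult_left_le_one_le) (auto simp: drlr_feasible_def)
    finally show ?thesis .
  qed
  moreover have "infnorm (t *\<^sub>R \<beta>) \<le> t * l"
    using assms by (auto simp: drlr_feasible_def infnorm_mul intro: mult_left_mono)
  ultimately show ?thesis
    using assms(1) by (auto simp: drlr_feasible_def swap algebra_simps)
qed

lemma logloss_shrink_le:
  assumes "0 < t" "t \<le> 1"
  shows "logloss (t *\<^sub>R \<beta>) x y - logloss \<beta> x y \<le> (1 - t) / t * 0.2785"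
proof -
  define z where "z = y * (\<beta> \<bullet> x)"
  have "logloss (t *\<^sub>R \<beta>) x y - logloss \<beta> x y
      = ln (1 + exp (- (t * z))) - ln (1 + exp (- z))"
    by (simp add: logloss_def z_def mult_ac)
  also have "\<dots> \<le> (z - t * z) / (1 + exp (t * z))"
    by (rule ln_add_exp_uminus_diff_le)
  \<comment> \<open>Expressing \<open>z\<close> through \<open>u = t * z\<close> makes the bound
    independent of the margin, at the cost of a factor \<open>1 / t\<close>.\<close>
  also have "\<dots> = (1 - t) / t * ((t * z) / (1 + exp (t * z)))"
    using assms by (simp add: algebra_simps diff_divide_distrib)
  also have "\<dots> \<le> (1 - t) / t * 0.2785"
    using assms by (intro mult_left_mono divide_add_exp_le) simp
  finally show ?thesis .
qed

theorem proposition3p1: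
  fixes \<epsilon> \<kappa> lam :: real
    and xh :: "'m::finite \<Rightarrow> real ^ 'n" and yh :: "'m \<Rightarrow> real"
    and \<beta> :: "real ^ 'n" and s :: "real ^ 'm"
  assumes "\<epsilon> > 0" and "\<kappa> > 0"
    and "\<forall>i. yh i \<in> {-1, 1}"
    and "drlr_optimal \<epsilon> \<kappa> xh yh (\<beta>, s, lam)"
  shows "lam \<le> 0.2785 / \<epsilon>"
proof -
  have feasible: "drlr_feasible \<kappa> xh yh (\<beta>, s, lam)"
    using assms(4) by (simp add: drlr_optimal_def is_arg_min_linorder)
  have minimal: "drlr_objective \<epsilon> (\<beta>, s, lam) \<le> drlr_objective \<epsilon> q"
      if "drlr_feasible \<kappa> xh yh q" for q
    using assms(4) that by (metis drlr_optimal_def is_arg_min_linorder)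
  have "t * (lam * \<epsilon>) \<le> 0.2785" if t: "0 < t" "t < 1" for t
  proof -
    let ?d = "\<lambda>i. logloss (t *\<^sub>R \<beta>) (xh i) (yh i) - logloss \<beta> (xh i) (yh i)"
    have "drlr_objective \<epsilon> (\<beta>, s, lam)
        \<le> drlr_objective \<epsilon> (t *\<^sub>R \<beta>, \<chi> i. s $ i + ?d i, t * lam)"
      using t by (intro minimal drlr_feasible_shrink feasible) simp_all
    then have "(1 - t) * (lam * \<epsilon>) \<le> (\<Sum>i\<in>UNIV. ?d i) / real CARD('m)"
      by (simp add: drlr_objective_def sum.distrib add_divide_distrib left_diff_distrib mult.assoc)
    also have "\<dots> \<le> (\<Sum>i\<in>(UNIV :: 'm set). (1 - t) / t * 0.2785) / real CARD('m)"
      using t by (intro divide_right_mono sum_mono logloss_shrink_le) simp_all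
    also have "\<dots> = (1 - t) * (0.2785 / t)"
      by simp
    \<comment> \<open>Cancelling \<open>1 - t\<close> requires the strict
      \<open>t < 1\<close>.\<close>
    finally have "lam * \<epsilon> \<le> 0.2785 / t"
      by (rule mult_left_le_imp_le) (use t in simp)
    then show ?thesis
      using t by (simp add: field_simps)
  qed
  then have "lam * \<epsilon> \<le> 0.2785"
    by (rule field_le_mult_one_interval)
  then show ?thesis
    using \<open>\<epsilon> > 0\<close> by (simp add: le_divide_eq)
qed

end
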